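(* For any $x\in\mathbb{R}^n$, $\varphi(x,\cdot):\mathbb{R}^{|\mathcal{S}|}\to\mathbb{R}^{|\mathcal{S}|}$ is a contraction mapping, i.e., $\|\nabla_v\varphi(x,v)\|_\infty=\gamma<1$ for every $v\in\mathbb{R}^{|\mathcal{S}|}$, and the matrix $I-\nabla_v\varphi(x,v)$ is invertible. Consequently, $V^*(x)$ is the unique fixed point of $\varphi(x,\cdot)$, and it has a well-defined derivative $\nabla V^*(x)\in\mathbb{R}^{|\mathcal{S}|\times n}$, given by $$\nabla V^*(x)=\left(I-\nabla_v\varphi(x,V^*(x))\right)^{-1}\nabla_x\varphi(x,V^*(x)).$$ Additionally, $\nabla_v\varphi(x,V^*(x))=\gamma P^{\pi^*(x)}$.
   Context: Let $\mathcal{S},\mathcal{A}$ be finite nonempty sets, $P_{sas'}=P(s'|s,a)$ a transition kernel (for each $(s,a)$, $P_{sa\cdot}$ is a probability distribution on $\mathcal{S}$), $\gamma\in(0,1)$, $\tau>0$, and $r:\mathbb{R}^n\to\mathbb{R}^{|\mathcal{S}||\mathcal{A}|}$, $x\mapsto (r_{sa}(x))_{sa}$, a continuously differentiable parameterized reward. A policy is $\pi=(\pi_s)_{s\in\mathcal{S}}$ with each $\pi_s=\pi(\cdot|s)$ a probability distribution on $\mathcal{A}$. $P^\pi\in\mathbb{R}^{|\mathcal{S}|\times|\mathcal{S}|}$ is defined by $P^\pi_{ss'}=\sum_a\pi_{sa}P_{sas'}$. With $h(\pi_s)=-\sum_a\pi_{sa}\log\pi_{sa}$ (convention $0\log 0=0$),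 the soft value function is $V^\pi_s(x)=\mathbb{E}[\sum_{t\ge0}\gamma^t(r_{s_ta_t}(x)+\tau h(\pi_{s_t}))\mid s_0=s,\pi]$, where $a_t\sim\pi(\cdot|s_t)$, $s_{t+1}\sim P(\cdot|s_t,a_t)$. Let $\rho$ be a distribution on $\mathcal{S}$ with all entries positive; $\pi^*(x)$ is the unique maximizer over all policies of $\sum_s\rho_sV^\pi_s(x)$ (it is independent of $\rho$), and $V^*(x)=V^{\pi^*(x)}(x)\in\mathbb{R}^{|\mathcal{S}|}$. The map $\varphi:\mathbb{R}^n\times\mathbb{R}^{|\mathcal{S}|}\to\mathbb{R}^{|\mathcal{S}|}$ is $$\varphi_s(x,v)=\tau\log\sum_{a\in\mathcal{A}}\exp\left(\frac{r_{sa}(x)+\gamma\sum_{s'}P_{sas'}v_{s'}}{\tau}\right).$$ $\nabla_x\varphi\in\mathbb{R}^{|\mathcal{S}|\times n}$ and $\nabla_v\varphi\in\mathbb{R}^{|\mathcal{S}|\times|\mathcal{S}|}$ are its partial Jacobians; $\|\cdot\|_\infty$ of a matrix is the operator norm induced by the sup norm (maximum absolute row sum). *)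

theory Defs
  imports "HOL-Probability.Probability"
begin

section \<open>Matrices and Jacobians\<close>

text \<open>The operator norm induced by the sup norm; the quotient at \<open>v = 0\<close> is \<open>0\<close>, as in
  the definition of \<^const>\<open>onorm\<close>.\<close>

definition opnorm_inf :: "real^'n^'m \<Rightarrow> real" where
  "opnorm_inf A = (SUP v. infnorm (A *v v) / infnorm v)"

lemma infnorm_le_cart: "infnorm (x::real^'n) \<le> B \<longleftrightarrow> (\<forall>i. \<bar>x $ i\<bar> \<le> B)"
proof -
  have *: "{\<bar>x $ i\<bar> |i. i \<in> UNIV} = range (\<lambda>i. \<bar>x $ i\<bar>)"
    by auto
  show ?thesis
    unfolding infnorm_cart * by (subst cSup_eq_Max) auto
qed

lemma opnorm_inf_eq_max_row_sum:
  fixes A :: "real^'n^'m"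
  shows "opnorm_inf A = (MAX i. \<Sum>j\<in>UNIV. \<bar>A $ i $ j\<bar>)" (is "_ = ?R")
proof -
  have row: "(\<Sum>j\<in>UNIV. \<bar>A $ i $ j\<bar>) \<le> ?R" for i
    by (rule Max_ge) auto
  have R0: "0 \<le> ?R"
    by (rule order_trans[OF _ row]) (rule sum_nonneg, simp)
  have upper: "infnorm (A *v v) / infnorm v \<le> ?R" for v
  proof (cases "v = 0")
    case True
    then show ?thesis using R0 by (simp add: infnorm_0)
  next
    case False
    then have pos: "infnorm v > 0"
      by (metis infnorm_eq_0 infnorm_pos_le less_eq_real_def)
    have "\<bar>(A *v v) $ i\<bar> \<le> ?R * infnorm v" for i
    proof -
      have "\<bar>(A *v v) $ i\<bar> \<le> (\<Sum>j\<in>UNIV. \<bar>A $ i $ j\<bar> * \<bar>v $ j\<bar>)"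
        by (simp add: matrix_vector_mult_def abs_mult[symmetric] sum_abs)
      also have "\<dots> \<le> (\<Sum>j\<in>UNIV. \<bar>A $ i $ j\<bar> * infnorm v)"
        by (intro sum_mono mult_left_mono component_le_infnorm_cart) auto
      also have "\<dots> \<le> ?R * infnorm v"
        unfolding sum_distrib_right[symmetric] by (intro mult_right_mono row infnorm_pos_le)
      finally show ?thesis .
    qed
    then show ?thesis
      using pos by (simp add: infnorm_le_cart pos_divide_le_eq)
  qed
  have "?R \<in> range (\<lambda>i. \<Sum>j\<in>UNIV. \<bar>A $ i $ j\<bar>)"
    by (rule Max_in) auto
  then obtain i where i: "?R = (\<Sum>j\<in>UNIV. \<bar>A $ i $ j\<bar>)"
    by (rule rangeE)
  define v :: "real^'n" where "v = (\<chi> j. if A $ i $ j < 0 then - 1 else 1)"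
  have v: "\<bar>v $ j\<bar> = 1" for j
    by (simp add: v_def)
  have "infnorm v = 1"
  proof (rule antisym)
    show "infnorm v \<le> 1" by (simp add: infnorm_le_cart v)
    show "1 \<le> infnorm v" using component_le_infnorm_cart[of v undefined] by (simp add: v)
  qed
  moreover have "(A *v v) $ i = ?R"
    unfolding i by (auto simp: matrix_vector_mult_def v_def intro!: sum.cong)
  ultimately have "?R \<le> infnorm (A *v v) / infnorm v"
    using component_le_infnorm_cart[of "A *v v" i] R0 by (simp only: abs_of_nonneg div_by_1)
  also have "\<dots> \<le> opnorm_inf A"
    unfolding opnorm_inf_def by (rule cSUP_upper) (auto intro!: bdd_aboveI[of _ ?R] upper)
  finally show ?thesis
    by (intro antisym) (auto simp: opnorm_inf_def intro!: cSUP_least upper)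
qed

definition infnorm_contraction :: "real \<Rightarrow> (real^'m \<Rightarrow> real^'m) \<Rightarrow> bool" where
  "infnorm_contraction c f \<longleftrightarrow>
     0 \<le> c \<and> c < 1 \<and> (\<forall>u v. infnorm (f u - f v) \<le> c * infnorm (u - v))"

definition continuously_differentiable :: "(real^'n \<Rightarrow> real^'m) \<Rightarrow> bool" where
  "continuously_differentiable f \<longleftrightarrow>
     (\<forall>x. f differentiable (at x)) \<and> continuous_on UNIV (\<lambda>x. jacobian f (at x))"

definition grad_x :: "(real^'n \<Rightarrow> real^'k \<Rightarrow> real^'m) \<Rightarrow> real^'n \<Rightarrow> real^'k \<Rightarrow> real^'n^'m" where
  "grad_x f x v = jacobian (\<lambda>y. f y v) (at x)"

definition grad_v :: "(real^'n \<Rightarrow> real^'k \<Rightarrow> real^'m) \<Rightarrow> real^'n \<Rightarrow> real^'k \<Rightarrow> real^'k^'m" where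
  "grad_v f x v = jacobian (\<lambda>w. f x w) (at v)"

section \<open>Trajectories of a Markov decision process\<close>

text \<open>The transition kernel \<open>P\<close> and the policy \<open>\<pi>\<close> are families of probability mass functions:
  \<open>pmf (P s a) s'\<close> is $P_{sas'}$ and \<open>pmf (\<pi> s) a\<close> is $\pi_{sa}$.  The point \<open>\<omega> t\<close> of a trajectory
  \<open>\<omega>\<close> is the state-action pair at time \<open>t\<close>.\<close>

definition state_action :: "('s \<Rightarrow> 'a pmf) \<Rightarrow> 's pmf \<Rightarrow> ('s \<times> 'a) pmf" where
  "state_action \<pi> p = bind_pmf p (\<lambda>s. map_pmf (Pair s) (\<pi> s))"

definition trajectory_kernel ::
  "('s \<Rightarrow> 'a \<Rightarrow> 's pmf) \<Rightarrow> ('s \<Rightarrow> 'a pmf) \<Rightarrow> 's \<Rightarrow> nat \<Rightarrow> (nat \<Rightarrow> 's \<times> 'a) \<Rightarrow> ('s \<times> 'a) measure" where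
  "trajectory_kernel P \<pi> s t \<omega> = measure_pmf (state_action \<pi>
     (case t of 0 \<Rightarrow> return_pmf s | Suc k \<Rightarrow> P (fst (\<omega> k)) (snd (\<omega> k))))"

text \<open>The law of the trajectory started in \<open>s\<close>, by the Ionescu-Tulcea theorem.\<close>

definition trajectory ::
  "('s \<Rightarrow> 'a \<Rightarrow> 's pmf) \<Rightarrow> ('s \<Rightarrow> 'a pmf) \<Rightarrow> 's \<Rightarrow> (nat \<Rightarrow> 's \<times> 'a) measure" where
  "trajectory P \<pi> s = projective_family.lim UNIV
     (Ionescu_Tulcea.CI (trajectory_kernel P \<pi> s) (\<lambda>_. count_space UNIV)) (\<lambda>_. count_space UNIV)"

lemma Ionescu_Tulcea_trajectory:
  fixes P :: "'s::finite \<Rightarrow> 'a::finite \<Rightarrow> 's pmf"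
  shows "Ionescu_Tulcea (trajectory_kernel P \<pi> s) (\<lambda>_. count_space UNIV)"
proof (rule Ionescu_Tulcea.intro)
  fix t :: nat
  show "trajectory_kernel P \<pi> s t \<in>
    measurable (PiM {0..<t} (\<lambda>_. count_space UNIV)) (subprob_algebra (count_space UNIV))"
  proof (cases t)
    case 0
    then show ?thesis
      by (simp add: trajectory_kernel_def[abs_def] measure_pmf_in_subprob_algebra)
  next
    case (Suc k)
    have "(\<lambda>\<omega>. \<omega> k) \<in> measurable (PiM {0..<t} (\<lambda>_. count_space UNIV))
        (count_space (UNIV :: ('s \<times> 'a) set))"
      by (rule measurable_component_singleton) (simp add: Suc)
    moreover have "(\<lambda>z. measure_pmf (state_action \<pi> (P (fst z) (snd z)))) \<in>
        measurable (count_space UNIV) (subprob_algebra (count_space UNIV))"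
      by (simp add: measure_pmf_in_subprob_algebra)
    ultimately have "(\<lambda>\<omega>. measure_pmf (state_action \<pi> (P (fst (\<omega> k)) (snd (\<omega> k))))) \<in>
      measurable (PiM {0..<t} (\<lambda>_. count_space UNIV)) (subprob_algebra (count_space UNIV))"
      by (rule measurable_compose)
    then show ?thesis
      by (simp add: trajectory_kernel_def[abs_def] Suc)
  qed
qed (unfold trajectory_kernel_def, rule prob_space_measure_pmf)

lemma sets_trajectory:
  fixes P :: "'s::finite \<Rightarrow> 'a::finite \<Rightarrow> 's pmf"
  shows "sets (trajectory P \<pi> s) = sets (PiM UNIV (\<lambda>_. count_space UNIV))"
proof -
  interpret Ionescu_Tulcea "trajectory_kernel P \<pi> s" "\<lambda>_. count_space UNIV"
    by (rule Ionescu_Tulcea_trajectory)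
  show ?thesis
    unfolding trajectory_def by simp
qed

lemma emeasure_trajectory_cylinder:
  fixes P :: "'s::finite \<Rightarrow> 'a::finite \<Rightarrow> 's pmf"
  shows "emeasure (trajectory P \<pi> s) {\<omega>. \<forall>i<n. \<omega> i = w i} =
    (\<Prod>i<n. emeasure (trajectory_kernel P \<pi> s i w) {w i})"
proof -
  interpret I: Ionescu_Tulcea "trajectory_kernel P \<pi> s" "\<lambda>_. count_space UNIV"
    by (rule Ionescu_Tulcea_trajectory)
  let ?M = "\<lambda>n. PiM {0..<n} (\<lambda>_::nat. count_space (UNIV :: ('s \<times> 'a) set))"
  let ?W = "\<lambda>n. {restrict w {0..<n}}"
  have W: "?W n = PiE {0..<n} (\<lambda>i. {w i})" for n
    by (auto simp: PiE_iff extensional_def restrict_def fun_eq_iff)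
  have W_sets: "?W n \<in> sets (?M n)" for n
    unfolding W by (rule sets_PiM_I_finite) auto
  have spc: "space (?M 0) = {\<lambda>_. undefined}"
    by (simp add: space_PiM)
  have C: "emeasure (I.C 0 n (\<lambda>_. undefined)) (?W n) =
      (\<Prod>i<n. emeasure (trajectory_kernel P \<pi> s i w) {w i})" for n
  proof (induction n)
    case 0
    then show ?case
      using emeasure_return[OF W_sets[of 0], of "\<lambda>_. undefined"] by (simp add: restrict_def)
  next
    case (Suc n)
    let ?c = "emeasure (trajectory_kernel P \<pi> s n w) {w n}"
    have C_sets: "sets (I.C 0 n (\<lambda>_. undefined)) = sets (?M n)"
      using I.sets_C[of "\<lambda>_. undefined" 0 n] by (simp add: spc)
    have C_space: "space (I.C 0 n (\<lambda>_. undefined)) = space (?M n)"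
      by (rule sets_eq_imp_space_eq[OF C_sets])
    have ker: "trajectory_kernel P \<pi> s n (restrict w {0..<n}) = trajectory_kernel P \<pi> s n w"
      by (cases n) (auto simp: trajectory_kernel_def)
    have eP: "emeasure (I.eP n y) (?W (Suc n)) = ?c * indicator (?W n) y"
      if y: "y \<in> space (?M n)" for y
    proof -
      have "(fun_upd y n -` ?W (Suc n)) = (if y \<in> ?W n then {w n} else {})"
      proof -
        have ext: "y \<in> extensional {0..<n}"
          using y by (simp add: space_PiM PiE_iff)
        have "y(n := z) = restrict w {0..<Suc n} \<longleftrightarrow> y = restrict w {0..<n} \<and> z = w n" for z
        proof
          assume eq: "y(n := z) = restrict w {0..<Suc n}"
          have "y i = restrict w {0..<n} i" for i
            using fun_cong[OF eq, of i] ext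
            by (cases "i = n") (auto simp: extensional_def split: if_splits)
          moreover have "z = w n"
            using fun_cong[OF eq, of n] by simp
          ultimately show "y = restrict w {0..<n} \<and> z = w n" by auto
        qed (auto simp: fun_eq_iff)
        then show ?thesis by auto
      qed
      then show ?thesis
        using y W_sets[of "Suc n"] by (simp add: I.emeasure_eP ker)
    qed
    have "emeasure (I.C 0 (Suc n) (\<lambda>_. undefined)) (?W (Suc n)) =
        (\<integral>\<^sup>+ y. emeasure (I.eP n y) (?W (Suc n)) \<partial>I.C 0 n (\<lambda>_. undefined))"
      unfolding I.C.simps add_0
    proof (rule emeasure_bind[where N="?M (Suc n)"])
      show "space (I.C 0 n (\<lambda>_. undefined)) \<noteq> {}"
        unfolding C_space by simp
      show "I.eP n \<in> measurable (I.C 0 n (\<lambda>_. undefined)) (subprob_algebra (?M (Suc n)))"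
        using I.measurable_eP[of n] by (simp add: measurable_cong_sets[OF C_sets refl])
    qed (rule W_sets)
    also have "\<dots> = (\<integral>\<^sup>+ y. ?c * indicator (?W n) y \<partial>I.C 0 n (\<lambda>_. undefined))"
      by (intro nn_integral_cong eP) (simp add: C_space)
    also have "\<dots> = ?c * emeasure (I.C 0 n (\<lambda>_. undefined)) (?W n)"
      using W_sets[of n] by (intro nn_integral_cmult_indicator) (simp add: C_sets)
    finally show ?case
      unfolding Suc.IH by (simp only: prod.lessThan_Suc mult.commute)
  qed
  have emb: "{\<omega>. \<forall>i<n. \<omega> i = w i} = I.PF.emb UNIV {0..<n} (?W n)"
    by (auto simp: prod_emb_def space_PiM PiE_iff fun_eq_iff restrict_def split: if_splits)
  have id: "I.PF.emb {0..<n} {0..<n} (?W n) = ?W n"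
    by (rule prod_emb_id) (auto simp: PiE_iff)
  show ?thesis
    unfolding trajectory_def emb
    by (subst I.lim[OF _ W_sets], simp, subst I.emeasure_CI[OF order_refl W_sets]) (simp add: id C)
qed

section \<open>Soft value functions and soft-optimal policies\<close>

text \<open>The convention $0 \log 0 = 0$ holds since \<open>ln 0 = 0\<close>.\<close>

definition policy_entropy :: "'a::finite pmf \<Rightarrow> real" where
  "policy_entropy p = - (\<Sum>a\<in>UNIV. pmf p a * ln (pmf p a))"

definition policy_transition ::
  "('s::finite \<Rightarrow> 'a::finite \<Rightarrow> 's pmf) \<Rightarrow> ('s \<Rightarrow> 'a pmf) \<Rightarrow> real^'s^'s" where
  "policy_transition P \<pi> = (\<chi> s s'. \<Sum>a\<in>UNIV. pmf (\<pi> s) a * pmf (P s a) s')"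

definition soft_value ::
  "('s::finite \<Rightarrow> 'a::finite \<Rightarrow> 's pmf) \<Rightarrow> real \<Rightarrow> real \<Rightarrow> (real^'n \<Rightarrow> real^('s \<times> 'a)) \<Rightarrow>
    ('s \<Rightarrow> 'a pmf) \<Rightarrow> real^'n \<Rightarrow> real^'s" where
  "soft_value P \<gamma> \<tau> r \<pi> x = (\<chi> s.
     \<integral>\<omega>. (\<Sum>t. \<gamma> ^ t * (r x $ (\<omega> t) + \<tau> * policy_entropy (\<pi> (fst (\<omega> t))))) \<partial>(trajectory P \<pi> s))"

text \<open>If there were no maximizer, or several, the \<open>THE\<close> below would be an unspecified policy; the
  unique existence for \<open>\<gamma> \<in> (0,1)\<close>, \<open>\<tau> > 0\<close> and entrywise positive \<open>\<rho>\<close> is not built in.\<close>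

definition opt_policy ::
  "('s::finite \<Rightarrow> 'a::finite \<Rightarrow> 's pmf) \<Rightarrow> real \<Rightarrow> real \<Rightarrow> (real^'n \<Rightarrow> real^('s \<times> 'a)) \<Rightarrow>
    's pmf \<Rightarrow> real^'n \<Rightarrow> 's \<Rightarrow> 'a pmf" where
  "opt_policy P \<gamma> \<tau> r \<rho> x =
     (THE \<pi>. is_arg_max (\<lambda>\<pi>. \<Sum>s\<in>UNIV. pmf \<rho> s * soft_value P \<gamma> \<tau> r \<pi> x $ s) (\<lambda>_. True) \<pi>)"

definition opt_value ::
  "('s::finite \<Rightarrow> 'a::finite \<Rightarrow> 's pmf) \<Rightarrow> real \<Rightarrow> real \<Rightarrow> (real^'n \<Rightarrow> real^('s \<times> 'a)) \<Rightarrow>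
    's pmf \<Rightarrow> real^'n \<Rightarrow> real^'s" where
  "opt_value P \<gamma> \<tau> r \<rho> x = soft_value P \<gamma> \<tau> r (opt_policy P \<gamma> \<tau> r \<rho> x) x"

definition soft_bellman ::
  "('s::finite \<Rightarrow> 'a::finite \<Rightarrow> 's pmf) \<Rightarrow> real \<Rightarrow> real \<Rightarrow> (real^'n \<Rightarrow> real^('s \<times> 'a)) \<Rightarrow>
    real^'n \<Rightarrow> real^'s \<Rightarrow> real^'s" where
  "soft_bellman P \<gamma> \<tau> r x v = (\<chi> s.
     \<tau> * ln (\<Sum>a\<in>UNIV. exp ((r x $ (s, a) + \<gamma> * (\<Sum>s'\<in>UNIV. pmf (P s a) s' * v $ s')) / \<tau>)))"

end

theory Submission
  imports Defs
begin

text \<open>Gibbs' variational principle turns the soft Bellman map into the maximum over policies of the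
  evaluation maps whose fixed points are the soft value functions; the maximum at a state is attained
  only by the Gibbs distribution of the action values.  Comparing the fixed point of the contraction
  with the value of an arbitrary policy shows that the fixed point dominates every soft value function
  and that only its greedy policy attains it, so this policy is the unique maximizer.  The fixed point
  then depends differentiably on the parameter: contractivity bounds its increments by those of the
  map, which makes the remainder in the Taylor expansion of the fixed point equation negligible.\<close>

section \<open>Expectations along a trajectory\<close>

text \<open>The transition operator of the Markov chain of state-action pairs, acting on functions:
  the conditional expectation of \<open>f\<close> at the next pair when the current pair is
  \<open>z\<close>.\<close>

definition backup ::
  "('s::finite \<Rightarrow> 'a::finite \<Rightarrow> 's pmf) \<Rightarrow> ('s \<Rightarrow> 'a pmf) \<Rightarrow> ('s \<times> 'a \<Rightarrow> real) \<Rightarrow> 's \<times> 'a \<Rightarrow> real"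
  where
  "backup P \<pi> f z = (\<Sum>s\<in>UNIV. pmf (P (fst z) (snd z)) s * (\<Sum>a\<in>UNIV. pmf (\<pi> s) a * f (s, a)))"

lemma sum_pmf_UNIV: "(\<Sum>x\<in>UNIV. pmf (p :: 'a::finite pmf) x) = 1"
  by (rule sum_pmf_eq_1) auto

lemma expectation_state_action:
  fixes \<pi> :: "'s::finite \<Rightarrow> 'a::finite pmf"
  shows "(\<Sum>z\<in>UNIV. pmf (state_action \<pi> p) z * f z) =
    (\<Sum>s\<in>UNIV. pmf p s * (\<Sum>a\<in>UNIV. pmf (\<pi> s) a * f (s, a)))"
proof -
  \<comment> \<open>In the mixture over states only the component of \<open>s\<close> itself charges
    \<open>(s, a)\<close>, so the joint mass factorizes.\<close>
  have "pmf (map_pmf (Pair s') (\<pi> s')) (s, a) = (if s' = s then pmf (\<pi> s') a else 0)" for s s' a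
    by (auto simp: pmf_map_inj' inj_def intro!: pmf_map_outside)
  then have "pmf (state_action \<pi> p) (s, a) = pmf p s * pmf (\<pi> s) a" for s a
    by (simp add: state_action_def pmf_bind integral_measure_pmf_real[of UNIV] if_distrib[of "\<lambda>x. x * _"]
        cong: if_cong)
  then show ?thesis
    by (simp add: UNIV_Times_UNIV[symmetric] sum.cartesian_product' sum_distrib_left mult.assoc
        del: UNIV_Times_UNIV)
qed

context
  fixes P :: "'s::finite \<Rightarrow> 'a::finite \<Rightarrow> 's pmf" and \<pi> :: "'s \<Rightarrow> 'a pmf" and s :: 's
begin

lemma space_trajectory: "space (trajectory P \<pi> s) = UNIV"
  using sets_eq_imp_space_eq[OF sets_trajectory[of P \<pi> s]] by (simp add: space_PiM)

lemma prob_space_trajectory: "prob_space (trajectory P \<pi> s)"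
  \<comment> \<open>The cylinder of length \<open>0\<close> is the whole space and its measure is
    the empty product.\<close>
  using emeasure_trajectory_cylinder[of P \<pi> s 0]
  by (intro prob_spaceI) (simp add: space_trajectory)

lemma measurable_trajectory_component [measurable]:
  "(\<lambda>\<omega>. \<omega> t) \<in> measurable (trajectory P \<pi> s) (count_space UNIV)"
  unfolding measurable_cong_sets[OF sets_trajectory refl]
  by (rule measurable_component_singleton) simp

text \<open>The Markov property. The cylinder formula covers only events that fix all coordinates up
  to some time, so both events are split into the finitely many histories that reach
  \<open>z\<close> at time \<open>n\<close>. The factor for the next pair is the same for all of
  these histories.\<close>

lemma measure_trajectory_step:
  "measure (trajectory P \<pi> s) {\<omega>. \<omega> n = z \<and> \<omega> (Suc n) = z'} =
   measure (trajectory P \<pi> s) {\<omega>. \<omega> n = z} * pmf (state_action \<pi> (P (fst z) (snd z))) z'"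
proof -
  let ?T = "trajectory P \<pi> s"
  interpret prob_space ?T by (rule prob_space_trajectory)
  define cyl where "cyl m w = {\<omega> :: nat \<Rightarrow> 's \<times> 'a. \<forall>i<m. \<omega> i = w i}" for m w
  \<comment> \<open>Histories up to time \<open>n\<close> that end in \<open>z\<close>, taken as
    extensional functions: there are finitely many, and distinct ones differ at some time up to
    \<open>n\<close>, which makes their cylinders disjoint.\<close>
  define W where "W = {w \<in> PiE {..n} (\<lambda>_. UNIV :: ('s \<times> 'a) set). w n = z}"
  have fin: "finite W"
    unfolding W_def by (intro finite_subset[OF _ finite_PiE[of "{..n}"]]) auto
  have cyl_sets: "cyl m w \<in> sets ?T" for m w
  proof -
    have "{\<omega> \<in> space ?T. \<forall>i<m. \<omega> i = w i} \<in> sets ?T" by measurable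
    then show ?thesis by (simp add: cyl_def space_trajectory)
  qed
  have ext: "w = w'" if "w \<in> W" "w' \<in> W" "\<forall>i<Suc n. w i = w' i" for w w'
    using that unfolding W_def by (intro PiE_ext[of w "{..n}" _ w']) auto
  have cover: "restrict \<omega> {..n} \<in> W" if "\<omega> n = z" for \<omega>
    using that by (auto simp: W_def)
  have eq1: "{\<omega>. \<omega> n = z} = (\<Union>w\<in>W. cyl (Suc n) w)"
  proof safe
    fix \<omega> :: "nat \<Rightarrow> 's \<times> 'a" assume "z = \<omega> n"
    then show "\<omega> \<in> (\<Union>w\<in>W. cyl (Suc n) w)"
      by (intro UN_I[OF cover]) (auto simp: cyl_def)
  qed (auto simp: cyl_def W_def)
  have eq2: "{\<omega>. \<omega> n = z \<and> \<omega> (Suc n) = z'} = (\<Union>w\<in>W. cyl (Suc (Suc n)) (w(Suc n := z')))"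
  proof safe
    fix \<omega> :: "nat \<Rightarrow> 's \<times> 'a" assume "z = \<omega> n" "z' = \<omega> (Suc n)"
    then show "\<omega> \<in> (\<Union>w\<in>W. cyl (Suc (Suc n)) (w(Suc n := \<omega> (Suc n))))"
      by (intro UN_I[OF cover]) (auto simp: cyl_def less_Suc_eq)
  qed (auto simp: cyl_def W_def)
  have step: "measure ?T (cyl (Suc (Suc n)) (w(Suc n := z'))) =
      measure ?T (cyl (Suc n) w) * pmf (state_action \<pi> (P (fst z) (snd z))) z'" if "w \<in> W" for w
  proof -
    \<comment> \<open>The kernel at a positive time reads only the coordinate just before it, so
      overwriting coordinate \<open>Suc n\<close> leaves the kernels up to time \<open>Suc n\<close>
      unchanged.\<close>
    have ker: "trajectory_kernel P \<pi> s i (w(Suc n := z')) = trajectory_kernel P \<pi> s i w"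
      if "i \<le> Suc n" for i
      using that by (auto simp: trajectory_kernel_def split: nat.splits)
    have "emeasure ?T (cyl (Suc (Suc n)) (w(Suc n := z'))) =
        emeasure ?T (cyl (Suc n) w) * ennreal (pmf (state_action \<pi> (P (fst z) (snd z))) z')"
      using \<open>w \<in> W\<close>
      unfolding cyl_def emeasure_trajectory_cylinder
      by (subst prod.lessThan_Suc)
        (simp add: ker trajectory_kernel_def[of P \<pi> s "Suc n"] emeasure_pmf_single W_def)
    then show ?thesis
      by (simp add: emeasure_eq_measure ennreal_mult[symmetric])
  qed
  have "measure ?T {\<omega>. \<omega> n = z \<and> \<omega> (Suc n) = z'} =
      (\<Sum>w\<in>W. measure ?T (cyl (Suc (Suc n)) (w(Suc n := z'))))"
    unfolding eq2
  proof (rule finite_measure_finite_Union[OF fin])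
    show "disjoint_family_on (\<lambda>w. cyl (Suc (Suc n)) (w(Suc n := z'))) W"
      unfolding disjoint_family_on_def
    proof (intro ballI impI, rule ccontr)
      fix w w' assume w: "w \<in> W" "w' \<in> W" "w \<noteq> w'"
        and "cyl (Suc (Suc n)) (w(Suc n := z')) \<inter> cyl (Suc (Suc n)) (w'(Suc n := z')) \<noteq> {}"
      then obtain \<omega> where "\<forall>i<Suc (Suc n). \<omega> i = (w(Suc n := z')) i"
        "\<forall>i<Suc (Suc n). \<omega> i = (w'(Suc n := z')) i"
        by (auto simp: cyl_def)
      then have "\<forall>i<Suc n. w i = w' i"
        by (metis fun_upd_other less_SucI less_irrefl)
      with ext w show False by blast
    qed
  qed (auto simp: cyl_sets)
  also have "\<dots> = (\<Sum>w\<in>W. measure ?T (cyl (Suc n) w)) * pmf (state_action \<pi> (P (fst z) (snd z))) z'"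
    unfolding sum_distrib_right by (intro sum.cong step refl)
  also have "(\<Sum>w\<in>W. measure ?T (cyl (Suc n) w)) = measure ?T {\<omega>. \<omega> n = z}"
    unfolding eq1
  proof (rule finite_measure_finite_Union[OF fin, symmetric])
    show "disjoint_family_on (cyl (Suc n)) W"
      unfolding disjoint_family_on_def
    proof (intro ballI impI, rule ccontr)
      fix w w' assume w: "w \<in> W" "w' \<in> W" "w \<noteq> w'" and "cyl (Suc n) w \<inter> cyl (Suc n) w' \<noteq> {}"
      then have "\<forall>i<Suc n. w i = w' i" by (auto simp: cyl_def)
      with ext w show False by blast
    qed
  qed (auto simp: cyl_sets)
  finally show ?thesis .
qed

text \<open>There are finitely many state-action pairs, so \<open>f\<close> at time \<open>t\<close>
  is a finite combination of indicators.\<close>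

lemma integral_trajectory_component:
  fixes f :: "'s \<times> 'a \<Rightarrow> real"
  shows "integrable (trajectory P \<pi> s) (\<lambda>\<omega>. f (\<omega> t))"
    and "(\<integral>\<omega>. f (\<omega> t) \<partial>trajectory P \<pi> s) =
      (\<Sum>z\<in>UNIV. measure (trajectory P \<pi> s) {\<omega>. \<omega> t = z} * f z)"
proof -
  let ?T = "trajectory P \<pi> s"
  interpret prob_space ?T by (rule prob_space_trajectory)
  have m [measurable]: "{\<omega>. \<omega> t = z} \<in> sets ?T" for z
    using measurable_sets[OF measurable_trajectory_component, of "{z}" t]
    by (simp add: space_trajectory vimage_def)
  have eq: "f (\<omega> t) = (\<Sum>z\<in>UNIV. indicator {\<omega>. \<omega> t = z} \<omega> * f z)" for \<omega> :: "nat \<Rightarrow> 's \<times> 'a"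
    by (simp add: indicator_def if_distrib cong: if_cong)
  show "integrable ?T (\<lambda>\<omega>. f (\<omega> t))"
    unfolding eq by (intro Bochner_Integration.integrable_sum integrable_mult_left integrable_real_indicator)
      (auto simp: less_top[symmetric])
  show "(\<integral>\<omega>. f (\<omega> t) \<partial>?T) = (\<Sum>z\<in>UNIV. measure ?T {\<omega>. \<omega> t = z} * f z)"
    unfolding eq
    by (subst Bochner_Integration.integral_sum)
       (auto intro!: integrable_mult_left integrable_real_indicator simp: less_top[symmetric])
qed

lemma integral_trajectory_0:
  "(\<integral>\<omega>. f (\<omega> 0) \<partial>trajectory P \<pi> s) = (\<Sum>a\<in>UNIV. pmf (\<pi> s) a * f (s, a) :: real)"
proof -
  have "emeasure (trajectory P \<pi> s) {\<omega>. \<omega> 0 = z} = ennreal (pmf (state_action \<pi> (return_pmf s)) z)" for z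
    using emeasure_trajectory_cylinder[of P \<pi> s 1 "\<lambda>_. z"]
    by (simp add: trajectory_kernel_def emeasure_pmf_single)
  then show ?thesis
    by (simp add: integral_trajectory_component measure_def expectation_state_action
        indicator_def if_distrib cong: if_cong)
qed

text \<open>Splits off the last transition, by summing the Markov property over the pair at time
  \<open>t\<close>.\<close>

lemma integral_trajectory_Suc:
  "(\<integral>\<omega>. f (\<omega> (Suc t)) \<partial>trajectory P \<pi> s) = (\<integral>\<omega>. backup P \<pi> f (\<omega> t) \<partial>trajectory P \<pi> s)"
proof -
  let ?T = "trajectory P \<pi> s"
  interpret prob_space ?T by (rule prob_space_trajectory)
  have m: "{\<omega>. \<omega> t = z \<and> \<omega> (Suc t) = z'} \<in> sets ?T" for z z'
  proof -
    have "{\<omega> \<in> space ?T. \<omega> t = z \<and> \<omega> (Suc t) = z'} \<in> sets ?T" by measurable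
    then show ?thesis by (simp add: space_trajectory)
  qed
  have "measure ?T {\<omega>. \<omega> (Suc t) = z'} =
      (\<Sum>z\<in>UNIV. measure ?T {\<omega>. \<omega> t = z} * pmf (state_action \<pi> (P (fst z) (snd z))) z')" for z'
  proof -
    have "{\<omega>. \<omega> (Suc t) = z'} = (\<Union>z. {\<omega>. \<omega> t = z \<and> \<omega> (Suc t) = z'})" by auto
    also have "measure ?T \<dots> = (\<Sum>z\<in>UNIV. measure ?T {\<omega>. \<omega> t = z \<and> \<omega> (Suc t) = z'})"
      by (rule finite_measure_finite_Union) (auto simp: m disjoint_family_on_def)
    finally show ?thesis by (simp add: measure_trajectory_step)
  qed
  then show ?thesis
    unfolding integral_trajectory_component(2)[of f] integral_trajectory_component(2)[of "backup P \<pi> f"]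
    unfolding backup_def expectation_state_action[symmetric]
    by (simp add: sum_distrib_left sum_distrib_right mult.assoc) (rule sum.swap)
qed

end


text \<open>The evaluation equation needs the first transition split off, whereas the Markov
  property delivers the last one. Induction over all \<open>f\<close> bridges the two: replacing
  \<open>f\<close> by its backup lowers the time by one on both sides.\<close>

lemma integral_trajectory_first_step:
  fixes P :: "'s::finite \<Rightarrow> 'a::finite \<Rightarrow> 's pmf" and f :: "'s \<times> 'a \<Rightarrow> real"
  shows "(\<integral>\<omega>. f (\<omega> (Suc t)) \<partial>trajectory P \<pi> s) =
    (\<Sum>a\<in>UNIV. pmf (\<pi> s) a * (\<Sum>s'\<in>UNIV. pmf (P s a) s' * (\<integral>\<omega>. f (\<omega> t) \<partial>trajectory P \<pi> s')))"
proof (induction t arbitrary: f)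
  case 0
  show ?case
    unfolding integral_trajectory_Suc integral_trajectory_0 by (simp add: backup_def)
next
  case (Suc t)
  show ?case
    unfolding integral_trajectory_Suc[where f = f] by (rule Suc.IH)
qed

section \<open>The evaluation equation of a fixed policy\<close>

definition action_value ::
  "('s::finite \<Rightarrow> 'a::finite \<Rightarrow> 's pmf) \<Rightarrow> real \<Rightarrow> (real^'n \<Rightarrow> real^('s \<times> 'a)) \<Rightarrow>
    real^'n \<Rightarrow> real^'s \<Rightarrow> 's \<Rightarrow> 'a \<Rightarrow> real" where
  "action_value P \<gamma> r x v s a = r x $ (s, a) + \<gamma> * (\<Sum>s'\<in>UNIV. pmf (P s a) s' * v $ s')"

text \<open>Expectation and discounted series may be exchanged, since the terms are dominated by a
  geometric series. Splitting off the first term, and the first transition in each later term, then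
  gives the equation.\<close>

lemma soft_value_evaluation:
  assumes "0 < \<gamma>" "\<gamma> < 1"
  shows "soft_value P \<gamma> \<tau> r \<pi> x $ s =
    (\<Sum>a\<in>UNIV. pmf (\<pi> s) a * action_value P \<gamma> r x (soft_value P \<gamma> \<tau> r \<pi> x) s a)
      + \<tau> * policy_entropy (\<pi> s)"
proof -
  define g where "g z = r x $ z + \<tau> * policy_entropy (\<pi> (fst z))" for z
  define c where "c t s = (\<integral>\<omega>. g (\<omega> t) \<partial>trajectory P \<pi> s)" for t s
  \<comment> \<open>Any bound on \<open>g\<close> uniform over the finitely many pairs
    serves.\<close>
  define B where "B = (\<Sum>z\<in>UNIV. \<bar>g z\<bar>)"
  have B: "\<bar>g z\<bar> \<le> B" for z
    unfolding B_def by (rule member_le_sum) auto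
  have sumB: "summable (\<lambda>t. \<gamma> ^ t * B)"
    using assms by (intro summable_mult2 summable_geometric) auto
  have cB: "\<bar>c t s\<bar> \<le> B" for t s
  proof -
    interpret prob_space "trajectory P \<pi> s" by (rule prob_space_trajectory)
    have "\<bar>c t s\<bar> \<le> (\<integral>\<omega>. \<bar>g (\<omega> t)\<bar> \<partial>trajectory P \<pi> s)"
      unfolding c_def by (rule integral_abs_bound)
    also have "\<dots> \<le> (\<integral>\<omega>. B \<partial>trajectory P \<pi> s)"
      by (intro integral_mono integrable_abs integral_trajectory_component B
        integrable_const)
    finally show ?thesis by (simp add: prob_space)
  qed
  have sumc: "summable (\<lambda>t. \<gamma> ^ t * c t s)" for s
    using assms cB by (intro summable_comparison_test'[OF sumB, of 0]) (simp add: abs_mult)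
  have V: "soft_value P \<gamma> \<tau> r \<pi> x $ s = (\<Sum>t. \<gamma> ^ t * c t s)" for s
  proof -
    have "soft_value P \<gamma> \<tau> r \<pi> x $ s = (\<integral>\<omega>. (\<Sum>t. \<gamma> ^ t * g (\<omega> t)) \<partial>trajectory P \<pi> s)"
      by (simp add: soft_value_def g_def)
    also have "\<dots> = (\<Sum>t. \<integral>\<omega>. \<gamma> ^ t * g (\<omega> t) \<partial>trajectory P \<pi> s)"
    proof (rule integral_suminf)
      show "integrable (trajectory P \<pi> s) (\<lambda>\<omega>. \<gamma> ^ t * g (\<omega> t))" for t
        by (intro integrable_mult_right integral_trajectory_component)
      show "AE \<omega> in trajectory P \<pi> s. summable (\<lambda>t. norm (\<gamma> ^ t * g (\<omega> t)))"
        using assms B by (intro AE_I2 summable_comparison_test'[OF sumB, of 0]) (simp add: abs_mult)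
      interpret prob_space "trajectory P \<pi> s" by (rule prob_space_trajectory)
      have "(\<integral>\<omega>. norm (\<gamma> ^ t * g (\<omega> t)) \<partial>trajectory P \<pi> s) \<le> \<gamma> ^ t * B" for t
      proof -
        have "(\<integral>\<omega>. norm (\<gamma> ^ t * g (\<omega> t)) \<partial>trajectory P \<pi> s) \<le> (\<integral>\<omega>. \<gamma> ^ t * B \<partial>trajectory P \<pi> s)"
          using assms B
          by (intro integral_mono integrable_norm integrable_mult_right integral_trajectory_component)
            (auto simp: abs_mult)
        then show ?thesis by (simp add: prob_space)
      qed
      then show "summable (\<lambda>t. \<integral>\<omega>. norm (\<gamma> ^ t * g (\<omega> t)) \<partial>trajectory P \<pi> s)"
        by (intro summable_comparison_test'[OF sumB, of 0]) (simp del: norm_mult)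
    qed
    finally show ?thesis by (simp add: c_def)
  qed
  have c0: "c 0 s = (\<Sum>a\<in>UNIV. pmf (\<pi> s) a * r x $ (s, a)) + \<tau> * policy_entropy (\<pi> s)"
    unfolding c_def integral_trajectory_0[where f = g]
    by (simp add: g_def distrib_left sum.distrib
        sum_distrib_right[symmetric] sum_pmf_UNIV)
  \<comment> \<open>The tail carries one extra factor \<gamma>; conditioning on the first transition
    turns it into an average of the same series started at the successor states.\<close>
  have "(\<Sum>t. \<gamma> ^ Suc t * c (Suc t) s) =
      (\<Sum>t. \<gamma> * (\<Sum>a\<in>UNIV. pmf (\<pi> s) a * (\<Sum>s'\<in>UNIV. pmf (P s a) s' * (\<gamma> ^ t * c t s'))))"
    unfolding c_def integral_trajectory_first_step
    by (simp add: sum_distrib_left mult_ac)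
  also have "\<dots> = \<gamma> * (\<Sum>a\<in>UNIV. pmf (\<pi> s) a * (\<Sum>s'\<in>UNIV. pmf (P s a) s' * (\<Sum>t. \<gamma> ^ t * c t s')))"
    by (intro sums_unique[symmetric] sums_mult sums_sum summable_sums sumc)
  finally show ?thesis
    unfolding V[of s] suminf_split_head[OF sumc, symmetric]
    using suminf_split_head[OF sumc[of s]]
    by (simp add: c0 V[symmetric] action_value_def distrib_left sum.distrib sum_distrib_left mult_ac)
qed

section \<open>Gibbs' variational principle and the optimal policy\<close>

text \<open>The softmax distribution of \<open>q\<close> at temperature
  \<open>\<tau>\<close>.\<close>

definition gibbs_pmf :: "real \<Rightarrow> ('a::finite \<Rightarrow> real) \<Rightarrow> 'a pmf" where
  "gibbs_pmf \<tau> q = embed_pmf (\<lambda>a. exp (q a / \<tau>) / (\<Sum>b\<in>UNIV. exp (q b / \<tau>)))"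

lemma sum_exp_pos: "0 < (\<Sum>b\<in>UNIV. exp (f (b::'a::finite) :: real))"
  by (rule sum_pos) auto

lemma pmf_gibbs_pmf: "pmf (gibbs_pmf \<tau> q) a = exp (q a / \<tau>) / (\<Sum>b\<in>UNIV. exp (q b / \<tau>))"
  unfolding gibbs_pmf_def
proof (rule pmf_embed_pmf)
  have pos: "0 < (\<Sum>b\<in>UNIV. exp (q b / \<tau>))" by (rule sum_exp_pos)
  then show "0 \<le> exp (q x / \<tau>) / (\<Sum>b\<in>UNIV. exp (q b / \<tau>))" for x by simp
  show "(\<integral>\<^sup>+ x. ennreal (exp (q x / \<tau>) / (\<Sum>b\<in>UNIV. exp (q b / \<tau>))) \<partial>count_space UNIV) = 1"
    using pos by (simp add: nn_integral_count_space_finite sum_ennreal less_imp_le sum_divide_distrib[symmetric])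
qed

text \<open>The summands of the Kullback-Leibler divergence, corrected by the zero-sum term
  \<open>q - p\<close>, are nonnegative one by one, which also settles the case of equality.\<close>

lemma kl_term_nonneg:
  fixes p q :: real
  assumes "0 \<le> p" "0 < q"
  shows "0 \<le> p * ln p - p * ln q - p + q"
    and "p * ln p - p * ln q - p + q = 0 \<Longrightarrow> p = q"
proof -
  have *: "p * ln p - p * ln q - p + q = p * (q / p - 1 - ln (q / p))" if "p > 0"
    using that assms by (simp add: ln_div field_simps)
  show "0 \<le> p * ln p - p * ln q - p + q"
  proof (cases "p = 0")
    case False
    then have "p > 0" using assms by simp
    moreover have "0 \<le> q / p - 1 - ln (q / p)"
      using ln_le_minus_one[of "q / p"] \<open>p > 0\<close> assms by simp
    ultimately show ?thesis using * by simp
  qed (use assms in simp)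
  assume eq: "p * ln p - p * ln q - p + q = 0"
  then have "p > 0" using assms by (cases "p = 0") auto
  then have "ln (q / p) = q / p - 1" using * eq by simp
  then have "q / p = 1" using \<open>p > 0\<close> assms by (intro ln_eq_minus_one) auto
  then show "p = q" using \<open>p > 0\<close> by simp
qed

text \<open>The gap between the two sides is \<tau> times the Kullback-Leibler divergence of
  \<open>p\<close> from the Gibbs distribution, because the logarithm of a Gibbs mass is
  \<open>q a / \<tau> - ln Z\<close>. The divergence is nonnegative and vanishes only at the Gibbs
  distribution.\<close>

lemma gibbs_variational:
  fixes p :: "'a::finite pmf"
  assumes "0 < \<tau>"
  shows "(\<Sum>a\<in>UNIV. pmf p a * q a) + \<tau> * policy_entropy p \<le> \<tau> * ln (\<Sum>a\<in>UNIV. exp (q a / \<tau>))"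
    and "(\<Sum>a\<in>UNIV. pmf p a * q a) + \<tau> * policy_entropy p = \<tau> * ln (\<Sum>a\<in>UNIV. exp (q a / \<tau>))
      \<longleftrightarrow> p = gibbs_pmf \<tau> q"
proof -
  define g where "g = gibbs_pmf \<tau> q"
  define k where "k a = pmf p a * ln (pmf p a) - pmf p a * ln (pmf g a) - pmf p a + pmf g a" for a
  define Z where "Z = (\<Sum>a\<in>UNIV. exp (q a / \<tau>))"
  have Z: "Z > 0" unfolding Z_def by (rule sum_exp_pos)
  have g: "pmf g a = exp (q a / \<tau>) / Z" for a
    by (simp add: g_def pmf_gibbs_pmf Z_def)
  have g_pos: "pmf g a > 0" for a using Z by (simp add: g)
  \<comment> \<open>Both distributions have total mass one, so the corrections in \<open>k\<close>
    cancel in the sum.\<close>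
  have "\<tau> * (\<Sum>a\<in>UNIV. k a) = \<tau> * (\<Sum>a\<in>UNIV. pmf p a * ln (pmf p a)) - \<tau> * (\<Sum>a\<in>UNIV. pmf p a * ln (pmf g a))"
    by (simp add: k_def sum.distrib sum_subtractf sum_pmf_UNIV algebra_simps)
  also have "\<tau> * (\<Sum>a\<in>UNIV. pmf p a * ln (pmf g a)) = (\<Sum>a\<in>UNIV. pmf p a * q a - pmf p a * (\<tau> * ln Z))"
    unfolding sum_distrib_left using Z assms by (intro sum.cong) (auto simp: g ln_div field_simps)
  also have "\<dots> = (\<Sum>a\<in>UNIV. pmf p a * q a) - \<tau> * ln Z"
    by (simp add: sum_subtractf sum_distrib_right[symmetric] sum_pmf_UNIV)
  finally have gap: "\<tau> * ln Z - ((\<Sum>a\<in>UNIV. pmf p a * q a) + \<tau> * policy_entropy p) = \<tau> * (\<Sum>a\<in>UNIV. k a)"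
    by (simp add: policy_entropy_def)
  have k: "0 \<le> k a" for a
    unfolding k_def by (rule kl_term_nonneg) (auto simp: g_pos)
  have "0 \<le> \<tau> * (\<Sum>a\<in>UNIV. k a)"
    using assms k by (simp add: sum_nonneg)
  with gap show "(\<Sum>a\<in>UNIV. pmf p a * q a) + \<tau> * policy_entropy p \<le> \<tau> * ln (\<Sum>a\<in>UNIV. exp (q a / \<tau>))"
    by (simp add: Z_def)
  have "\<tau> * (\<Sum>a\<in>UNIV. k a) = 0 \<longleftrightarrow> p = g"
  proof
    assume "\<tau> * (\<Sum>a\<in>UNIV. k a) = 0"
    then have "k a = 0" for a
      using assms k by (simp add: sum_nonneg_eq_0_iff)
    then have "pmf p a = pmf g a" for a
      unfolding k_def by (rule kl_term_nonneg(2)[OF pmf_nonneg g_pos])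
    then show "p = g" by (rule pmf_eqI)
  qed (simp add: k_def)
  with gap show "(\<Sum>a\<in>UNIV. pmf p a * q a) + \<tau> * policy_entropy p = \<tau> * ln (\<Sum>a\<in>UNIV. exp (q a / \<tau>))
      \<longleftrightarrow> p = gibbs_pmf \<tau> q"
    by (auto simp: Z_def g_def)
qed

section \<open>Contractivity of the soft Bellman map\<close>

lemma soft_bellman_nth:
  "soft_bellman P \<gamma> \<tau> r x v $ s = \<tau> * ln (\<Sum>a\<in>UNIV. exp (action_value P \<gamma> r x v s a / \<tau>))"
  by (simp add: soft_bellman_def action_value_def)

lemma action_value_le:
  assumes "0 \<le> \<gamma>" "\<And>s'. u $ s' \<le> v $ s' + c"
  shows "action_value P \<gamma> r x u s a \<le> action_value P \<gamma> r x v s a + \<gamma> * c"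
proof -
  have "(\<Sum>s'\<in>UNIV. pmf (P s a) s' * u $ s') \<le> (\<Sum>s'\<in>UNIV. pmf (P s a) s' * (v $ s' + c))"
    by (intro sum_mono mult_left_mono assms) simp
  also have "\<dots> = (\<Sum>s'\<in>UNIV. pmf (P s a) s' * v $ s') + c"
    by (simp add: distrib_left sum.distrib sum_distrib_right[symmetric] sum_pmf_UNIV)
  finally show ?thesis
    using mult_left_mono[OF _ assms(1)] by (fastforce simp: action_value_def distrib_left)
qed

text \<open>Log-sum-exp is monotone, and a constant added to \<open>v\<close> leaves it multiplied
  by \<gamma>: Blackwell's two conditions in one inequality.\<close>

lemma soft_bellman_le:
  assumes "0 \<le> \<gamma>" "0 < \<tau>" "\<And>s'. u $ s' \<le> v $ s' + c"
  shows "soft_bellman P \<gamma> \<tau> r x u $ s \<le> soft_bellman P \<gamma> \<tau> r x v $ s + \<gamma> * c"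
proof -
  have "(\<Sum>a\<in>UNIV. exp (action_value P \<gamma> r x u s a / \<tau>)) \<le>
      (\<Sum>a\<in>UNIV. exp (action_value P \<gamma> r x v s a / \<tau> + \<gamma> * c / \<tau>))"
    using assms by (intro sum_mono) (simp add: add_divide_distrib[symmetric] divide_right_mono action_value_le)
  also have "\<dots> = (\<Sum>a\<in>UNIV. exp (action_value P \<gamma> r x v s a / \<tau>)) * exp (\<gamma> * c / \<tau>)"
    by (simp add: exp_add sum_distrib_right)
  finally have "ln (\<Sum>a\<in>UNIV. exp (action_value P \<gamma> r x u s a / \<tau>)) \<le>
      ln ((\<Sum>a\<in>UNIV. exp (action_value P \<gamma> r x v s a / \<tau>)) * exp (\<gamma> * c / \<tau>))"
    by (subst ln_le_cancel_iff) (auto intro!: mult_pos_pos sum_exp_pos)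
  also have "\<dots> = ln (\<Sum>a\<in>UNIV. exp (action_value P \<gamma> r x v s a / \<tau>)) + \<gamma> * c / \<tau>"
    using sum_exp_pos[of "\<lambda>a. action_value P \<gamma> r x v s a / \<tau>"] by (simp add: ln_mult)
  finally show ?thesis
    using assms(2) by (simp add: soft_bellman_nth field_simps)
qed

text \<open>The one-sided bound with shift \<open>infnorm (u - v)\<close>, used for both orders of
  \<open>u\<close> and \<open>v\<close>.\<close>

lemma soft_bellman_contraction:
  assumes "0 < \<gamma>" "\<gamma> < 1" "0 < \<tau>"
  shows "infnorm_contraction \<gamma> (soft_bellman P \<gamma> \<tau> r x)"
proof -
  have le: "soft_bellman P \<gamma> \<tau> r x u $ s \<le> soft_bellman P \<gamma> \<tau> r x v $ s + \<gamma> * infnorm (u - v)" for u v s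
  proof (rule soft_bellman_le)
    fix s' show "u $ s' \<le> v $ s' + infnorm (u - v)"
      using component_le_infnorm_cart[of "u - v" s'] by simp
  qed (use assms in auto)
  have "infnorm (soft_bellman P \<gamma> \<tau> r x u - soft_bellman P \<gamma> \<tau> r x v) \<le> \<gamma> * infnorm (u - v)" for u v
    using le[of u _ v] le[of v _ u] by (auto simp: infnorm_le_cart abs_le_iff infnorm_sub[of v u] algebra_simps)
  then show ?thesis
    using assms by (simp add: infnorm_contraction_def)
qed

text \<open>A contraction in the sup norm need not contract the Euclidean norm, but it is Lipschitz
  there and hence continuous. Existence therefore comes from Brouwer's theorem on a box, and
  contractivity gives uniqueness.\<close>

lemma infnorm_contraction_fixed_point:
  fixes f :: "real^'m \<Rightarrow> real^'m"
  assumes "infnorm_contraction c f"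
  shows "\<exists>!v. f v = v"
proof -
  have c: "0 \<le> c" "c < 1" "\<And>u v. infnorm (f u - f v) \<le> c * infnorm (u - v)"
    using assms by (auto simp: infnorm_contraction_def)
  \<comment> \<open>The radius solves \<open>c * R + infnorm (f 0) = R\<close>, so that
    \<open>f\<close> maps the box into itself.\<close>
  define R where "R = infnorm (f 0) / (1 - c)"
  define S where "S = {v :: real^'m. infnorm v \<le> R}"
  have S: "S = cbox (\<chi> i. - R) (\<chi> i. R)"
    by (auto simp: S_def infnorm_le_cart mem_box_cart abs_le_iff minus_le_iff)
  have R0: "R \<ge> 0"
    using c by (simp add: R_def infnorm_pos_le)
  have lip: "norm (f u - f v) \<le> sqrt (DIM(real^'m)) * norm (u - v)" for u v
  proof -
    have "norm (f u - f v) \<le> sqrt (DIM(real^'m)) * infnorm (f u - f v)"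
      by (rule norm_le_infnorm)
    also have "infnorm (f u - f v) \<le> 1 * infnorm (u - v)"
      using c(3)[of u v] c(2) infnorm_pos_le[of "u - v"] by (meson mult_right_mono less_imp_le order_trans)
    also have "\<dots> \<le> norm (u - v)"
      by (simp add: infnorm_le_norm)
    finally show ?thesis by (simp add: mult_left_mono)
  qed
  have "continuous_on S f"
  proof (rule lipschitz_on_continuous_on[OF lipschitz_onI])
    show "dist (f u) (f v) \<le> sqrt (DIM(real^'m)) * dist u v" for u v
      using lip by (simp add: dist_norm)
  qed simp
  moreover have "f \<in> S \<rightarrow> S"
  proof
    fix v assume "v \<in> S"
    have "infnorm (f v) \<le> infnorm (f v - f 0) + infnorm (f 0)"
      using infnorm_triangle[of "f v - f 0" "f 0"] by simp
    also have "\<dots> \<le> c * R + infnorm (f 0)"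
      using c(3)[of v 0] \<open>v \<in> S\<close> c(1) mult_left_mono[of "infnorm v" R c] by (simp add: S_def)
    also have "\<dots> = R"
      using c(2) by (simp add: R_def field_simps)
    finally show "f v \<in> S" by (simp add: S_def)
  qed
  moreover have "compact S" "convex S" "S \<noteq> {}"
  proof -
    have "0 \<in> S" using R0 by (simp add: S_def infnorm_0)
    then show "S \<noteq> {}" by blast
  qed (simp_all add: S convex_box)
  ultimately obtain v where v: "f v = v"
    using brouwer[of S f] by blast
  moreover have "u = v" if "f u = u" for u
  proof -
    have "(1 - c) * infnorm (u - v) \<le> 0"
      using c(3)[of u v] that v by (simp add: algebra_simps)
    then have "infnorm (u - v) \<le> 0"
      using c(2) by (simp add: mult_le_0_iff)
    then show ?thesis
      using infnorm_pos_le[of "u - v"] by (simp add: infnorm_eq_0)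
  qed
  ultimately show ?thesis by blast
qed

section \<open>The fixed point as optimal value and the greedy policy as optimal policy\<close>

definition bellman_value where
  "bellman_value P \<gamma> \<tau> r x = (THE v. soft_bellman P \<gamma> \<tau> r x v = v)"

definition greedy_policy where
  "greedy_policy P \<gamma> \<tau> r x v s = gibbs_pmf \<tau> (action_value P \<gamma> r x v s)"

lemma bellman_value_iff:
  assumes "0 < \<gamma>" "\<gamma> < 1" "0 < \<tau>"
  shows "soft_bellman P \<gamma> \<tau> r x v = v \<longleftrightarrow> v = bellman_value P \<gamma> \<tau> r x"
proof -
  have ex1: "\<exists>!v. soft_bellman P \<gamma> \<tau> r x v = v"
    by (rule infnorm_contraction_fixed_point[OF soft_bellman_contraction[OF assms]])
  from theI'[OF this] the1_equality[OF this] show ?thesis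
    unfolding bellman_value_def by blast
qed

text \<open>A minimum principle: at a state \<open>m\<close> minimizing \<open>d\<close> the average
  is at least \<open>d $ m\<close>, hence \<open>d $ m\<close> is at least \<gamma> times itself,
  which excludes a negative minimum.\<close>

lemma nonneg_if_ge_discounted_average:
  fixes d :: "real^'s::finite"
  assumes "0 < \<gamma>" "\<gamma> < 1"
    and ge: "\<And>s. d $ s \<ge> \<gamma> * (\<Sum>a\<in>UNIV. pmf (\<pi> s) a * (\<Sum>s'\<in>UNIV. pmf (P s (a::'a::finite)) s' * d $ s'))"
  shows "0 \<le> d $ s"
proof -
  have "finite (range (\<lambda>s. d $ s))" by simp
  then have "Min (range (\<lambda>s. d $ s)) \<in> range (\<lambda>s. d $ s)" by (rule Min_in) simp
  then obtain m where "Min (range (\<lambda>s. d $ s)) = d $ m" by blast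
  then have m: "d $ m \<le> d $ s" for s
    using Min_le[of "range (\<lambda>s. d $ s)" "d $ s"] by simp
  have "d $ m = (\<Sum>a\<in>UNIV. pmf (\<pi> m) a * (\<Sum>s'\<in>UNIV. pmf (P m a) s' * d $ m))"
    by (simp add: sum_distrib_right[symmetric] sum_pmf_UNIV)
  also have "\<dots> \<le> (\<Sum>a\<in>UNIV. pmf (\<pi> m) a * (\<Sum>s'\<in>UNIV. pmf (P m a) s' * d $ s'))"
    by (intro sum_mono mult_left_mono m) auto
  finally have "\<gamma> * d $ m \<le> d $ m"
    using ge[of m] assms(1) by (smt (verit) mult_left_mono)
  then have "0 \<le> (1 - \<gamma>) * d $ m" by (simp add: algebra_simps)
  then have "0 \<le> d $ m" using assms(2) by (simp add: zero_le_mult_iff)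
  with m[of s] show ?thesis by simp
qed

text \<open>Gibbs' principle bounds one evaluation step \<open>Q v\<close> by \<open>v\<close>.
  Since \<open>?V\<close> is fixed by \<open>Q\<close>, the difference \<open>v - ?V\<close>
  satisfies the minimum principle. For the greedy policy the bound is an equality, and the principle
  applies to \<open>?V - v\<close> as well.\<close>

lemma soft_value_le_bellman_value:
  fixes P :: "'s::finite \<Rightarrow> 'a::finite \<Rightarrow> 's pmf" and r :: "real^'n \<Rightarrow> real^('s \<times> 'a)"
    and x :: "real^'n"
  assumes "0 < \<gamma>" "\<gamma> < 1" "0 < \<tau>"
  defines "v \<equiv> bellman_value P \<gamma> \<tau> r x"
  shows "soft_value P \<gamma> \<tau> r \<pi> x $ s \<le> v $ s"
    and "soft_value P \<gamma> \<tau> r \<pi> x = v \<longleftrightarrow> \<pi> = greedy_policy P \<gamma> \<tau> r x v"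
proof -
  let ?V = "soft_value P \<gamma> \<tau> r \<pi> x"
  define Q where "Q u s = (\<Sum>a\<in>UNIV. pmf (\<pi> s) a * action_value P \<gamma> r x u s a) + \<tau> * policy_entropy (\<pi> s)" for u s
  have fix_v: "v $ s = \<tau> * ln (\<Sum>a\<in>UNIV. exp (action_value P \<gamma> r x v s a / \<tau>))" for s
    using bellman_value_iff[OF assms(1-3), of P r x v] soft_bellman_nth[of P \<gamma> \<tau> r x v s] by (simp add: v_def)
  have V: "?V $ s = Q ?V s" for s
    unfolding Q_def by (rule soft_value_evaluation[OF assms(1,2)])
  have Q_le: "Q v s \<le> v $ s" and Q_eq: "Q v s = v $ s \<longleftrightarrow> \<pi> s = greedy_policy P \<gamma> \<tau> r x v s" for s
    unfolding Q_def fix_v greedy_policy_def by (rule gibbs_variational[OF assms(3)])+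
  \<comment> \<open>Rewards and entropy do not depend on the continuation value, so they
    cancel.\<close>
  have diff: "Q u s - Q w s =
      \<gamma> * (\<Sum>a\<in>UNIV. pmf (\<pi> s) a * (\<Sum>s'\<in>UNIV. pmf (P s a) s' * (u - w) $ s'))" for u w s
    by (simp add: Q_def action_value_def algebra_simps sum.distrib sum_subtractf sum_distrib_left)
  have le: "?V $ s \<le> v $ s" for s
  proof -
    have "(v - ?V) $ s \<ge> \<gamma> * (\<Sum>a\<in>UNIV. pmf (\<pi> s) a * (\<Sum>s'\<in>UNIV. pmf (P s a) s' * (v - ?V) $ s'))" for s
      using diff[of v s ?V] Q_le[of s] V[of s] unfolding vector_minus_component by linarith
    from nonneg_if_ge_discounted_average[OF assms(1,2) this, of s] show ?thesis by simp
  qed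
  then show "?V $ s \<le> v $ s" .
  show "?V = v \<longleftrightarrow> \<pi> = greedy_policy P \<gamma> \<tau> r x v"
  proof
    assume "?V = v"
    \<comment> \<open>For \<open>?V = v\<close> the evaluation equation reads
      \<open>Q v s = v $ s\<close>, the equality case of Gibbs' principle.\<close>
    with V Q_eq show "\<pi> = greedy_policy P \<gamma> \<tau> r x v" by (metis ext)
  next
    assume "\<pi> = greedy_policy P \<gamma> \<tau> r x v"
    with Q_eq have "Q v s = v $ s" for s by simp
    then have "(?V - v) $ s \<ge> \<gamma> * (\<Sum>a\<in>UNIV. pmf (\<pi> s) a * (\<Sum>s'\<in>UNIV. pmf (P s a) s' * (?V - v) $ s'))" for s
      using diff[of ?V s v] V[of s] unfolding vector_minus_component by (metis order_refl)
    from nonneg_if_ge_discounted_average[OF assms(1,2) this] have "v $ s \<le> ?V $ s" for s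
      by simp
    with le show "?V = v" by (simp add: vec_eq_iff order.antisym)
  qed
qed

text \<open>The greedy policy attains the upper bound \<open>?v\<close> at all states
  simultaneously, so every maximizer reaches the weighted bound. As all weights are positive, a
  maximizer leaves no gap at any state and is greedy by the equality case.\<close>

lemma opt_policy_eq_greedy_policy:
  fixes P :: "'s::finite \<Rightarrow> 'a::finite \<Rightarrow> 's pmf"
  assumes "0 < \<gamma>" "\<gamma> < 1" "0 < \<tau>" "\<forall>s. 0 < pmf \<rho> s"
  shows "opt_policy P \<gamma> \<tau> r \<rho> x = greedy_policy P \<gamma> \<tau> r x (bellman_value P \<gamma> \<tau> r x)"
proof -
  let ?v = "bellman_value P \<gamma> \<tau> r x"
  let ?J = "\<lambda>\<pi>. \<Sum>s\<in>UNIV. pmf \<rho> s * soft_value P \<gamma> \<tau> r \<pi> x $ s"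
  have le: "?J \<pi> \<le> (\<Sum>s\<in>UNIV. pmf \<rho> s * ?v $ s)" for \<pi>
    by (intro sum_mono mult_left_mono soft_value_le_bellman_value(1)[OF assms(1-3)]) simp
  have attained: "soft_value P \<gamma> \<tau> r (greedy_policy P \<gamma> \<tau> r x ?v) x = ?v"
    using soft_value_le_bellman_value(2)[OF assms(1-3)] by blast
  have unique: "\<pi> = greedy_policy P \<gamma> \<tau> r x ?v" if "?J \<pi> = (\<Sum>s\<in>UNIV. pmf \<rho> s * ?v $ s)" for \<pi>
  proof -
    have "(\<Sum>s\<in>UNIV. pmf \<rho> s * (?v $ s - soft_value P \<gamma> \<tau> r \<pi> x $ s)) = 0"
      using that by (simp add: right_diff_distrib sum_subtractf)
    then have "\<forall>s\<in>UNIV. pmf \<rho> s * (?v $ s - soft_value P \<gamma> \<tau> r \<pi> x $ s) = 0"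
      by (subst (asm) sum_nonneg_eq_0_iff)
        (auto intro!: mult_nonneg_nonneg soft_value_le_bellman_value(1)[OF assms(1-3)])
    then have "soft_value P \<gamma> \<tau> r \<pi> x = ?v"
      using assms(4) by (simp add: vec_eq_iff) (metis less_irrefl)
    then show ?thesis
      using soft_value_le_bellman_value(2)[OF assms(1-3)] by blast
  qed
  show ?thesis
    unfolding opt_policy_def
  proof (rule the_equality)
    show "is_arg_max ?J (\<lambda>_. True) (greedy_policy P \<gamma> \<tau> r x ?v)"
      using le by (auto simp: is_arg_max_def attained not_less)
    fix \<pi> assume "is_arg_max ?J (\<lambda>_. True) \<pi>"
    then have "\<not> ?J (greedy_policy P \<gamma> \<tau> r x ?v) > ?J \<pi>"
      by (simp add: is_arg_max_def)
    with le[of \<pi>] show "\<pi> = greedy_policy P \<gamma> \<tau> r x ?v"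
      by (intro unique) (simp add: attained)
  qed
qed

lemma opt_value_eq_bellman_value:
  assumes "0 < \<gamma>" "\<gamma> < 1" "0 < \<tau>" "\<forall>s. 0 < pmf \<rho> s"
  shows "opt_value P \<gamma> \<tau> r \<rho> x = bellman_value P \<gamma> \<tau> r x"
  unfolding opt_value_def
  by (rule iffD2[OF soft_value_le_bellman_value(2)[OF assms(1-3)] opt_policy_eq_greedy_policy[OF assms]])

section \<open>Differentiating the fixed point\<close>

lemma jacobian_eqI: "(f has_derivative f') (at x) \<Longrightarrow> jacobian f (at x) = matrix f'"
  by (simp add: jacobian_def frechet_derivative_at[symmetric])

lemma has_derivative_vec_nth:
  fixes f :: "'a::real_normed_vector \<Rightarrow> real^'m"
  assumes "\<And>i. ((\<lambda>x. f x $ i) has_derivative (\<lambda>x. f' x $ i)) (at a)"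
  shows "(f has_derivative f') (at a)"
  using assms unfolding has_derivative_componentwise_within[of f]
  by (auto simp: Basis_vec_def inner_axis)

text \<open>The gradient of log-sum-exp is the softmax. This is why the Jacobian in \<open>v\<close>
  turns out to be a discounted policy transition matrix.\<close>

lemma log_sum_exp_has_derivative:
  fixes q :: "'b::real_normed_vector \<Rightarrow> 'a::finite \<Rightarrow> real"
  assumes "0 < \<tau>" "\<And>a. ((\<lambda>p. q p a) has_derivative (\<lambda>h. q' h a)) (at p)"
  shows "((\<lambda>p. \<tau> * ln (\<Sum>a\<in>UNIV. exp (q p a / \<tau>))) has_derivative
    (\<lambda>h. \<Sum>a\<in>UNIV. pmf (gibbs_pmf \<tau> (q p)) a * q' h a)) (at p)"
proof -
  let ?Z = "\<Sum>a\<in>UNIV. exp (q p a / \<tau>)"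
  have Z: "0 < ?Z" by (rule sum_exp_pos)
  have "((\<lambda>p. exp (q p a / \<tau>)) has_derivative (\<lambda>h. exp (q p a / \<tau>) * (q' h a / \<tau>))) (at p)" for a
    using assms(1) by (auto intro!: derivative_eq_intros assms(2))
  then have "((\<lambda>p. \<Sum>a\<in>UNIV. exp (q p a / \<tau>)) has_derivative
      (\<lambda>h. \<Sum>a\<in>UNIV. exp (q p a / \<tau>) * (q' h a / \<tau>))) (at p)"
    by (rule has_derivative_sum)
  then have "((\<lambda>p. \<tau> * ln (\<Sum>a\<in>UNIV. exp (q p a / \<tau>))) has_derivative
      (\<lambda>h. \<tau> * ((\<Sum>a\<in>UNIV. exp (q p a / \<tau>) * (q' h a / \<tau>)) * inverse ?Z))) (at p)"
    using Z by (intro has_derivative_mult_right has_derivative_ln)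
  moreover have "\<tau> * ((\<Sum>a\<in>UNIV. exp (q p a / \<tau>) * (q' h a / \<tau>)) * inverse ?Z) =
      (\<Sum>a\<in>UNIV. pmf (gibbs_pmf \<tau> (q p)) a * q' h a)" for h
    unfolding sum_distrib_left sum_distrib_right using assms(1)
    by (intro sum.cong) (simp_all add: pmf_gibbs_pmf divide_inverse)
  ultimately show ?thesis by simp
qed

text \<open>Joint differentiability is needed, since the fixed point equation is expanded with
  parameter and value moving together.\<close>

lemma soft_bellman_has_derivative:
  fixes P :: "'s::finite \<Rightarrow> 'a::finite \<Rightarrow> 's pmf" and r :: "real^'n \<Rightarrow> real^('s \<times> 'a)"
  assumes "0 < \<tau>" "(r has_derivative r') (at x)"
  shows "((\<lambda>p. soft_bellman P \<gamma> \<tau> r (fst p) (snd p)) has_derivative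
    (\<lambda>p. \<chi> s. \<Sum>a\<in>UNIV. pmf (greedy_policy P \<gamma> \<tau> r x v s) a *
      (r' (fst p) $ (s, a) + \<gamma> * (\<Sum>s'\<in>UNIV. pmf (P s a) s' * snd p $ s')))) (at (x, v))"
proof (rule has_derivative_vec_nth)
  fix s
  have r: "((\<lambda>p. r (fst p)) has_derivative (\<lambda>p. r' (fst p))) (at (x, v))"
    by (rule has_derivative_compose[OF has_derivative_fst[OF has_derivative_ident]]) (simp add: assms(2))
  have "((\<lambda>p. action_value P \<gamma> r (fst p) (snd p) s a) has_derivative
      (\<lambda>p. r' (fst p) $ (s, a) + \<gamma> * (\<Sum>s'\<in>UNIV. pmf (P s a) s' * snd p $ s'))) (at (x, v))" for a
    unfolding action_value_def
    by (auto intro!: derivative_eq_intros bounded_linear.has_derivative[OF bounded_linear_vec_nth] r)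
  from log_sum_exp_has_derivative[OF assms(1) this]
  show "((\<lambda>p. soft_bellman P \<gamma> \<tau> r (fst p) (snd p) $ s) has_derivative
    (\<lambda>p. (\<chi> s. \<Sum>a\<in>UNIV. pmf (greedy_policy P \<gamma> \<tau> r x v s) a *
      (r' (fst p) $ (s, a) + \<gamma> * (\<Sum>s'\<in>UNIV. pmf (P s a) s' * snd p $ s'))) $ s)) (at (x, v))"
    by (simp add: soft_bellman_nth greedy_policy_def)
qed

text \<open>Implicit differentiation for an already given solution \<open>V\<close>. The residual
  bound \<open>lip\<close> makes \<open>V\<close> Lipschitz at \<open>x\<close>, so the remainder of
  \<open>f\<close> along \<open>(y, V y)\<close> is small relative to \<open>y - x\<close>; applying
  \<open>K\<close> solves the linearized equation for the increment of \<open>V\<close>.\<close>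

lemma implicit_fixed_point_has_derivative:
  fixes f :: "'a::real_normed_vector \<Rightarrow> 'b::real_normed_vector \<Rightarrow> 'b"
  assumes D: "((\<lambda>p. f (fst p) (snd p)) has_derivative D) (at (x, V x))"
    and fixed: "\<And>y. f y (V y) = V y"
    and lip: "\<And>y. norm (V y - V x) \<le> C * norm (f y (V x) - f x (V x))"
    and K: "bounded_linear K" "\<And>k. K (k - D (0, k)) = k"
  shows "(V has_derivative (\<lambda>h. K (D (h, 0)))) (at x)"
proof -
  interpret D: bounded_linear D using D by (rule has_derivative_bounded_linear)
  interpret K: bounded_linear K by (rule K(1))
  let ?A = "\<lambda>h. D (h, 0)"
  have "((\<lambda>y. (y, V x)) has_derivative (\<lambda>h. (h, 0))) (at x)"
    by (auto intro!: derivative_eq_intros)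
  from has_derivative_compose[OF this D]
  have A: "((\<lambda>y. f y (V x)) has_derivative ?A) (at x)" by simp
  interpret A: bounded_linear ?A using A by (rule has_derivative_bounded_linear)
  obtain M where M: "0 < M" "\<And>h. norm (?A h) \<le> norm h * M"
    using A.pos_bounded by blast
  obtain N where N: "0 < N" "\<And>k. norm (K k) \<le> norm k * N"
    using K.pos_bounded by blast
  \<comment> \<open>Tolerance \<open>1\<close> suffices here: only a linear bound with constant
    \<open>M + 1\<close> is wanted.\<close>
  obtain d1 where d1: "0 < d1"
    "\<And>y. norm (y - x) < d1 \<Longrightarrow> norm (f y (V x) - f x (V x) - ?A (y - x)) \<le> 1 * norm (y - x)"
    using A unfolding has_derivative_at_alt by (meson zero_less_one)
  \<comment> \<open>The absolute value is taken because \<open>C\<close> carries no sign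
    assumption.\<close>
  define L where "L = \<bar>C\<bar> * (M + 1)"
  have L0: "0 \<le> L" using M by (simp add: L_def)
  have L: "norm (V y - V x) \<le> L * norm (y - x)" if "norm (y - x) < d1" for y
  proof -
    have "norm (f y (V x) - f x (V x)) \<le> norm (f y (V x) - f x (V x) - ?A (y - x)) + norm (?A (y - x))"
      using norm_triangle_ineq[of "f y (V x) - f x (V x) - ?A (y - x)" "?A (y - x)"] by simp
    also have "\<dots> \<le> (M + 1) * norm (y - x)"
      using d1(2)[OF that] M(2)[of "y - x"] by (simp add: algebra_simps)
    finally have "\<bar>C\<bar> * norm (f y (V x) - f x (V x)) \<le> L * norm (y - x)"
      unfolding L_def mult.assoc by (rule mult_left_mono) simp
    moreover have "C * norm (f y (V x) - f x (V x)) \<le> \<bar>C\<bar> * norm (f y (V x) - f x (V x))"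
      by (rule mult_right_mono) auto
    ultimately show ?thesis using lip[of y] by linarith
  qed
  show ?thesis
    unfolding has_derivative_at_alt
  proof (intro conjI allI impI)
    show "bounded_linear (\<lambda>h. K (D (h, 0)))"
      by (rule bounded_linear_compose[OF K(1) A.bounded_linear_axioms])
    fix e :: real assume "0 < e"
    \<comment> \<open>Chosen to absorb the factor \<open>1 + L\<close> from passing to the pair of
      increments and the bound \<open>N\<close> on \<open>K\<close>.\<close>
    define e' where "e' = e / (N * (1 + L))"
    have "0 < e'" using \<open>0 < e\<close> N L0 by (simp add: e'_def)
    then obtain d2 where d2: "0 < d2"
      "\<And>p. norm (p - (x, V x)) < d2 \<Longrightarrow>
        norm (f (fst p) (snd p) - f x (V x) - D (p - (x, V x))) \<le> e' * norm (p - (x, V x))"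
      using D unfolding has_derivative_at_alt by (metis fst_conv snd_conv)
    show "\<exists>d>0. \<forall>y. norm (y - x) < d \<longrightarrow> norm (V y - V x - K (D (y - x, 0))) \<le> e * norm (y - x)"
    proof (intro exI[of _ "min d1 (d2 / (1 + L))"] conjI allI impI)
      show "0 < min d1 (d2 / (1 + L))" using d1 d2 L0 by simp
      fix y assume y: "norm (y - x) < min d1 (d2 / (1 + L))"
      let ?h = "y - x" and ?k = "V y - V x"
      have p: "norm (?h, ?k) \<le> (1 + L) * norm ?h"
        using norm_Pair_le[of ?h ?k] L[of y] y by (simp add: algebra_simps)
      also have "\<dots> < d2" using y L0 by (simp add: pos_less_divide_eq mult.commute)
      \<comment> \<open>By the fixed point equations at \<open>x\<close> and \<open>y\<close>, the
        increment of \<open>f\<close> is \<open>?k\<close> itself.\<close>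
      finally have "norm (?k - D (?h, ?k)) \<le> e' * norm (?h, ?k)"
        using d2(2)[of "(y, V y)"] by (simp add: fixed)
      also have "\<dots> \<le> e' * ((1 + L) * norm ?h)"
        using p \<open>0 < e'\<close> by simp
      also have "\<dots> = e / N * norm ?h"
        using L0 by (simp add: e'_def)
      finally have E: "norm (?k - D (?h, ?k)) \<le> e / N * norm ?h" .
      have "D (?h, ?k) = D (?h, 0) + D (0, ?k)"
        using D.add[of "(?h, 0)" "(0, ?k)"] by simp
      then have "?k - K (D (?h, 0)) = K (?k - D (?h, ?k))"
        using K(2)[of ?k] by (simp add: K.diff K.add)
      then have "norm (?k - K (D (?h, 0))) \<le> norm (?k - D (?h, ?k)) * N"
        using N(2) by simp
      also have "\<dots> \<le> e / N * norm ?h * N"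
        using E N(1) by (intro mult_right_mono) auto
      finally show "norm (?k - K (D (?h, 0))) \<le> e * norm ?h"
        using N(1) by simp
    qed
  qed
qed

text \<open>The a posteriori error estimate of the contraction principle, with the square root
  paying for the passage from sup norm to Euclidean norm. It supplies the residual bound for
  implicit differentiation.\<close>

lemma infnorm_contraction_fixed_point_dist:
  fixes f g :: "real^'m \<Rightarrow> real^'m"
  assumes "infnorm_contraction c f" "f u = u"
  shows "norm (u - v) \<le> sqrt (DIM(real^'m)) / (1 - c) * norm (f v - v)"
proof -
  have c: "c < 1" "infnorm (f u - f v) \<le> c * infnorm (u - v)"
    using assms(1) unfolding infnorm_contraction_def by blast+
  have "infnorm (u - v) \<le> infnorm (f u - f v) + infnorm (f v - v)"
    using infnorm_triangle[of "f u - f v" "f v - v"] assms(2) by simp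
  with c have "(1 - c) * infnorm (u - v) \<le> infnorm (f v - v)"
    by (simp add: algebra_simps)
  also have "\<dots> \<le> norm (f v - v)" by (rule infnorm_le_norm)
  finally have "infnorm (u - v) \<le> norm (f v - v) / (1 - c)"
    using c by (simp add: pos_le_divide_eq mult.commute)
  with norm_le_infnorm[of "u - v"] have "norm (u - v) \<le> sqrt (DIM(real^'m)) * (norm (f v - v) / (1 - c))"
    by (meson mult_left_mono order_trans real_sqrt_ge_zero of_nat_0_le_iff)
  then show ?thesis by simp
qed

section \<open>Discounted transition matrices and the Jacobians of the soft Bellman map\<close>

lemma policy_transition_mult:
  "policy_transition P \<pi> *v u = (\<chi> s. \<Sum>a\<in>UNIV. pmf (\<pi> s) a * (\<Sum>s'\<in>UNIV. pmf (P s a) s' * u $ s'))"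
  by (simp add: policy_transition_def matrix_vector_mult_def vec_eq_iff sum_distrib_left
      sum_distrib_right mult.assoc) (rule allI, rule sum.swap)

lemma opnorm_inf_policy_transition:
  assumes "0 \<le> \<gamma>"
  shows "opnorm_inf (\<gamma> *\<^sub>R policy_transition P \<pi>) = \<gamma>"
proof -
  have "(\<Sum>s'\<in>UNIV. \<bar>(\<gamma> *\<^sub>R policy_transition P \<pi>) $ s $ s'\<bar>) = \<gamma>" for s
  proof -
    \<comment> \<open>The entries are nonnegative, so absolute row sums are read off from the image
      of the all-ones vector.\<close>
    have "(\<Sum>s'\<in>UNIV. \<bar>(\<gamma> *\<^sub>R policy_transition P \<pi>) $ s $ s'\<bar>) = \<gamma> * (policy_transition P \<pi> *v 1) $ s"
      using assms by (simp add: policy_transition_def matrix_vector_mult_def abs_mult sum_nonneg sum_distrib_left)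
    then show ?thesis
      by (simp add: policy_transition_mult sum_pmf_UNIV)
  qed
  then show ?thesis by (simp add: opnorm_inf_eq_max_row_sum)
qed

lemma infnorm_matrix_vector_le: "infnorm (A *v v) \<le> opnorm_inf A * infnorm v"
  unfolding infnorm_le_cart
proof
  fix i
  have "\<bar>(A *v v) $ i\<bar> \<le> (\<Sum>j\<in>UNIV. \<bar>A $ i $ j\<bar> * \<bar>v $ j\<bar>)"
    by (simp add: matrix_vector_mult_def abs_mult[symmetric] sum_abs)
  also have "\<dots> \<le> (\<Sum>j\<in>UNIV. \<bar>A $ i $ j\<bar> * infnorm v)"
    by (intro sum_mono mult_left_mono component_le_infnorm_cart) auto
  also have "\<dots> \<le> opnorm_inf A * infnorm v"
    unfolding sum_distrib_right[symmetric] opnorm_inf_eq_max_row_sum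
    by (intro mult_right_mono infnorm_pos_le Max_ge) auto
  finally show "\<bar>(A *v v) $ i\<bar> \<le> opnorm_inf A * infnorm v" .
qed

text \<open>A kernel vector of \<open>mat 1 - A\<close> is fixed by \<open>A\<close>, which for norm
  below one forces it to be zero; a square matrix with trivial kernel is invertible.\<close>

lemma invertible_one_minus:
  fixes A :: "real^'m^'m"
  assumes "opnorm_inf A < 1"
  shows "invertible (mat 1 - A)"
proof -
  have "v = 0" if "(mat 1 - A) *v v = 0" for v
  proof (rule ccontr)
    assume "v \<noteq> 0"
    then have "0 < infnorm v"
      by (metis infnorm_eq_0 infnorm_pos_le less_eq_real_def)
    moreover have "A *v v = v"
      using that by (simp add: matrix_vector_mult_diff_rdistrib)
    ultimately show False
      using infnorm_matrix_vector_le[of A v] assms by simp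
  qed
  then show ?thesis
    unfolding invertible_left_inverse matrix_left_invertible_ker by blast
qed

lemma matrix_inv_left:
  "invertible A \<Longrightarrow> matrix_inv A ** A = mat 1"
  unfolding invertible_def matrix_inv_def by (rule someI_ex[THEN conjunct2])

text \<open>All four claims come from one joint derivative \<open>D\<close>: its slices at fixed
  parameter and at fixed value are the partial derivatives, and linearity reassembles
  \<open>D\<close> from them.\<close>

lemma
  fixes P :: "'s::finite \<Rightarrow> 'a::finite \<Rightarrow> 's pmf" and r :: "real^'n \<Rightarrow> real^('s \<times> 'a)"
  assumes "0 < \<tau>" "r differentiable (at x)"
  shows soft_bellman_has_derivative_v: "(soft_bellman P \<gamma> \<tau> r x has_derivative
      (\<lambda>k. (\<gamma> *\<^sub>R policy_transition P (greedy_policy P \<gamma> \<tau> r x v)) *v k)) (at v)" (is ?v)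
    and grad_v_soft_bellman: "grad_v (soft_bellman P \<gamma> \<tau> r) x v =
      \<gamma> *\<^sub>R policy_transition P (greedy_policy P \<gamma> \<tau> r x v)" (is ?gv)
    and soft_bellman_has_derivative_x: "((\<lambda>y. soft_bellman P \<gamma> \<tau> r y v) has_derivative
      (\<lambda>h. grad_x (soft_bellman P \<gamma> \<tau> r) x v *v h)) (at x)" (is ?x)
    and soft_bellman_has_derivative_joint:
      "((\<lambda>p. soft_bellman P \<gamma> \<tau> r (fst p) (snd p)) has_derivative
        (\<lambda>p. grad_x (soft_bellman P \<gamma> \<tau> r) x v *v fst p + grad_v (soft_bellman P \<gamma> \<tau> r) x v *v snd p))
        (at (x, v))" (is ?xv)
proof -
  obtain r' where r': "(r has_derivative r') (at x)"
    using assms(2) by (auto simp: differentiable_def)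
  obtain D where D: "((\<lambda>p. soft_bellman P \<gamma> \<tau> r (fst p) (snd p)) has_derivative D) (at (x, v))"
    and Dv: "D (0, k) = (\<gamma> *\<^sub>R policy_transition P (greedy_policy P \<gamma> \<tau> r x v)) *v k" for k
  proof (rule that[OF soft_bellman_has_derivative[OF assms(1) r']])
    have "r' 0 = 0"
      using r' by (rule linear_0[OF has_derivative_linear])
    then show "(\<chi> s. \<Sum>a\<in>UNIV. pmf (greedy_policy P \<gamma> \<tau> r x v s) a *
        (r' (fst (0, k)) $ (s, a) + \<gamma> * (\<Sum>s'\<in>UNIV. pmf (P s a) s' * snd (0, k) $ s'))) =
      (\<gamma> *\<^sub>R policy_transition P (greedy_policy P \<gamma> \<tau> r x v)) *v k" for k
      by (simp add: scaleR_matrix_vector_assoc[symmetric] policy_transition_mult vec_eq_iff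
          sum_distrib_left mult_ac)
  qed
  have "((\<lambda>w. (x, w)) has_derivative (\<lambda>k. (0, k))) (at v)"
    by (auto intro!: derivative_eq_intros)
  from has_derivative_compose[OF this D] show ?v by (simp add: Dv)
  from jacobian_eqI[OF this] show gv: ?gv
    by (simp add: grad_v_def matrix_of_matrix_vector_mul)
  have "((\<lambda>y. (y, v)) has_derivative (\<lambda>h. (h, 0))) (at x)"
    by (auto intro!: derivative_eq_intros)
  from has_derivative_compose[OF this D]
  have x: "((\<lambda>y. soft_bellman P \<gamma> \<tau> r y v) has_derivative (\<lambda>h. D (h, 0))) (at x)" by simp
  \<comment> \<open>The slice is linear, hence given by its matrix, and that matrix is the
    Jacobian.\<close>
  have Dx: "D (h, 0) = grad_x (soft_bellman P \<gamma> \<tau> r) x v *v h" for h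
    unfolding grad_x_def jacobian_eqI[OF x]
    by (rule matrix_works[symmetric]) (simp add: has_derivative_linear[OF x] add: linear_matrix_vector_mul_eq)
  show ?x using x by (simp add: Dx)
  have "D p = grad_x (soft_bellman P \<gamma> \<tau> r) x v *v fst p + grad_v (soft_bellman P \<gamma> \<tau> r) x v *v snd p" for p
    using linear_add[OF has_derivative_linear[OF D], of "(fst p, 0)" "(0, snd p)"]
    by (simp add: Dx Dv gv)
  then have "D = (\<lambda>p. grad_x (soft_bellman P \<gamma> \<tau> r) x v *v fst p + grad_v (soft_bellman P \<gamma> \<tau> r) x v *v snd p)"
    by (rule ext)
  with D show ?xv by simp
qed

text \<open>Implicit differentiation with \<open>K\<close> the inverse of \<open>?M\<close>, which
  exists because the discounted transition matrix has norm \<gamma>.\<close>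

lemma bellman_value_has_derivative:
  fixes P :: "'s::finite \<Rightarrow> 'a::finite \<Rightarrow> 's pmf" and r :: "real^'n \<Rightarrow> real^('s \<times> 'a)" and x :: "real^'n"
  assumes "0 < \<gamma>" "\<gamma> < 1" "0 < \<tau>" "r differentiable (at x)"
  defines "v \<equiv> bellman_value P \<gamma> \<tau> r x"
  shows "(bellman_value P \<gamma> \<tau> r has_derivative
    (\<lambda>h. (matrix_inv (mat 1 - grad_v (soft_bellman P \<gamma> \<tau> r) x v) **
      grad_x (soft_bellman P \<gamma> \<tau> r) x v) *v h)) (at x)"
proof -
  let ?f = "soft_bellman P \<gamma> \<tau> r"
  let ?M = "mat 1 - grad_v ?f x v"
  have fixed: "?f y (bellman_value P \<gamma> \<tau> r y) = bellman_value P \<gamma> \<tau> r y" for y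
    using bellman_value_iff[OF assms(1-3)] by blast
  have "opnorm_inf (grad_v ?f x v) < 1"
    using assms(1,2) by (simp add: grad_v_soft_bellman[OF assms(3,4)] opnorm_inf_policy_transition)
  then have inv: "matrix_inv ?M ** ?M = mat 1"
    by (intro matrix_inv_left invertible_one_minus)
  have "((bellman_value P \<gamma> \<tau> r) has_derivative
      (\<lambda>h. matrix_inv ?M *v (grad_x ?f x v *v fst (h, 0 :: real^'s) + grad_v ?f x v *v snd (h, 0 :: real^'s)))) (at x)"
  proof (rule implicit_fixed_point_has_derivative[where f = ?f
        and V = "bellman_value P \<gamma> \<tau> r" and K = "(*v) (matrix_inv ?M)"
        and D = "\<lambda>p. grad_x ?f x v *v fst p + grad_v ?f x v *v snd p"])
    show "((\<lambda>p. ?f (fst p) (snd p)) has_derivative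
        (\<lambda>p. grad_x ?f x v *v fst p + grad_v ?f x v *v snd p)) (at (x, bellman_value P \<gamma> \<tau> r x))"
      using soft_bellman_has_derivative_joint[OF assms(3,4)] by (simp add: v_def)
    show "norm (bellman_value P \<gamma> \<tau> r y - bellman_value P \<gamma> \<tau> r x) \<le> sqrt (DIM(real^'s)) / (1 - \<gamma>) *
        norm (?f y (bellman_value P \<gamma> \<tau> r x) - ?f x (bellman_value P \<gamma> \<tau> r x))" for y
      \<comment> \<open>At the fixed point for \<open>x\<close>, the residual of the map for
        \<open>y\<close> is exactly the change of the map from \<open>x\<close> to
        \<open>y\<close>.\<close>
      unfolding fixed[of x]
      by (intro infnorm_contraction_fixed_point_dist soft_bellman_contraction assms fixed)
    show "bounded_linear ((*v) (matrix_inv ?M))" by simp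
    show "matrix_inv ?M *v (k - (grad_x ?f x v *v fst (0, k) + grad_v ?f x v *v snd (0, k))) = k" for k
    proof -
      have "k - (grad_x ?f x v *v fst (0, k) + grad_v ?f x v *v snd (0, k)) = ?M *v k"
        by (simp add: matrix_vector_mult_diff_rdistrib)
      then show ?thesis by (simp add: matrix_vector_mul_assoc inv)
    qed
  qed (rule fixed)
  then show ?thesis by (simp add: matrix_vector_mul_assoc)
qed

theorem proposition4p1:
  fixes P :: "'s::finite \<Rightarrow> 'a::finite \<Rightarrow> 's pmf"
    and \<gamma> \<tau> :: real
    and r :: "real^'n \<Rightarrow> real^('s \<times> 'a)"
    and \<rho> :: "'s pmf"
    and x :: "real^'n"
  assumes "0 < \<gamma>" and "\<gamma> < 1" and "0 < \<tau>"
    and "continuously_differentiable r"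
    and "\<forall>s. 0 < pmf \<rho> s"
  shows "infnorm_contraction \<gamma> (soft_bellman P \<gamma> \<tau> r x) \<and>
    (\<forall>v. soft_bellman P \<gamma> \<tau> r x differentiable (at v) \<and>
         (\<lambda>y. soft_bellman P \<gamma> \<tau> r y v) differentiable (at x) \<and>
         opnorm_inf (grad_v (soft_bellman P \<gamma> \<tau> r) x v) = \<gamma> \<and> \<gamma> < 1 \<and>
         invertible (mat 1 - grad_v (soft_bellman P \<gamma> \<tau> r) x v)) \<and>
    (\<forall>v. soft_bellman P \<gamma> \<tau> r x v = v \<longleftrightarrow> v = opt_value P \<gamma> \<tau> r \<rho> x) \<and>
    opt_value P \<gamma> \<tau> r \<rho> differentiable (at x) \<and>
    jacobian (opt_value P \<gamma> \<tau> r \<rho>) (at x) =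
      matrix_inv (mat 1 - grad_v (soft_bellman P \<gamma> \<tau> r) x (opt_value P \<gamma> \<tau> r \<rho> x)) **
      grad_x (soft_bellman P \<gamma> \<tau> r) x (opt_value P \<gamma> \<tau> r \<rho> x) \<and>
    grad_v (soft_bellman P \<gamma> \<tau> r) x (opt_value P \<gamma> \<tau> r \<rho> x) =
      \<gamma> *\<^sub>R policy_transition P (opt_policy P \<gamma> \<tau> r \<rho> x)"
proof -
  have r: "r differentiable (at x)"
    using assms(4) by (simp add: continuously_differentiable_def)
  have opt: "opt_value P \<gamma> \<tau> r \<rho> = bellman_value P \<gamma> \<tau> r"
    using opt_value_eq_bellman_value[OF assms(1-3,5)] by (rule ext)
  have norm: "opnorm_inf (grad_v (soft_bellman P \<gamma> \<tau> r) x v) = \<gamma>" for v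
    using assms(1) by (simp add: grad_v_soft_bellman[OF assms(3) r] opnorm_inf_policy_transition)
  note deriv = bellman_value_has_derivative[OF assms(1-3) r, of P]
  show ?thesis
    unfolding opt
  proof (intro conjI allI)
    fix v
    show "soft_bellman P \<gamma> \<tau> r x differentiable (at v)"
      using soft_bellman_has_derivative_v[OF assms(3) r] by (rule differentiableI)
    show "(\<lambda>y. soft_bellman P \<gamma> \<tau> r y v) differentiable (at x)"
      using soft_bellman_has_derivative_x[OF assms(3) r] by (rule differentiableI)
    show "invertible (mat 1 - grad_v (soft_bellman P \<gamma> \<tau> r) x v)"
      using assms(2) by (intro invertible_one_minus) (simp add: norm)
    show "jacobian (bellman_value P \<gamma> \<tau> r) (at x) =
      matrix_inv (mat 1 - grad_v (soft_bellman P \<gamma> \<tau> r) x (bellman_value P \<gamma> \<tau> r x)) **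
      grad_x (soft_bellman P \<gamma> \<tau> r) x (bellman_value P \<gamma> \<tau> r x)"
      using jacobian_eqI[OF deriv] by (simp add: matrix_of_matrix_vector_mul)
  \<comment> \<open>The last conjunct holds because the softmax weights in the Jacobian at the fixed
    point form the greedy policy, which is the optimal one.\<close>
  qed (use assms differentiableI[OF deriv] in \<open>simp_all add: norm soft_bellman_contraction bellman_value_iff opnorm_inf_policy_transition
      grad_v_soft_bellman[OF assms(3) r] opt_policy_eq_greedy_policy\<close>)
qed

end
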